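(* In the status-good consumption game described in the context, there exists a unique equilibrium. For all agents $j$, equilibrium consumption is $$x_j^* = S'_x(Y_{\theta_j}^* )\cdot C_j,$$ where $Y_{\theta_j}^*$ solves $$Y_{\theta_j} = \frac{S'_x(Y_{\theta_j})\,\mathcal{C}_{\theta_j}}{S'_x\!\left(\frac{1}{Y_{\theta_j}}\right)\mathcal{C}_{-\theta_j}} .$$
   Context: Agents and network. There are $J$ agents. Agent $j$ has income $w_j\in[1,\infty)$ and a fixed identity $\theta_j\in\{A,B\}$; $-\theta$ denotes the identity other than $\theta$; $I(\theta)=\{k:\theta_k=\theta\}$. $G$ is a non-negative $J\times J$ matrix (a weighted directed network) with $G_{jj}=0$ for all $j$. Let $\widehat G_{jk}=G_{jk}\mathbf 1\{\theta_j=\theta_k\}$, let $\beta>0$, and $H_{jk}=\frac{\beta w_j}{\beta w_j+1}\widehat G_{jk}$. Centrality. $C_j=\sum_k[(I-H)^{-1}]_{jk}\frac{w_k}{\beta w_k+1}$ and $\mathcal C_\theta=\frac1{|I(\theta)|}\sum_{k\in I(\theta)}C_k$. Game. Agents simultaneously choose consumption $x_j\ge 0$. Agent $j$'s reference point is $R_j=\sum_{k\in I(\theta_j)} G_{jk}x_k=\sum_k\widehat G_{jk}x_k$. Group average consumption is $\mathbf x_\theta=\frac1{|I(\theta)|}\sum_{k\in I(\theta)}x_k$ and group status is $Y_\theta=\mathbf x_\theta/\mathbf x_{-\theta}$. Payoffs are $$u_j=S(x_j,Y_{\theta_j})-\tfrac12\beta(x_j-R_j)^2-\tfrac1{2w_j}x_j^2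 .$$ All primitives are common knowledge. Equilibrium means Nash equilibrium, where each agent $j$ ignores her own impact on $Y_{\theta_j}$ (treats it as fixed) when choosing $x_j$. Assumptions on $S$. Utility from own consumption is linear in $x$, so $S'_x=\partial S/\partial x$ is not a function of $x$ and is written $S'_x(Y)$. Moreover $S'_x>0$, $S'_Y>0$, $S''_{xY}<0$ for $x\in[0,X]$ and $Y\in[1/Z,Z]$, where $X\ge\psi\rho$, $Z\ge\psi(1+\beta)$, $\psi=\max_jC_j$ and $\rho=S'_x\!\left(\frac1{\psi(1+\beta)}\right)$. Standing assumption. The largest eigenvalue modulus of $G$ is less than $1$, and $\rho<\infty$ (with $\psi<\infty$).
   Formalization: Uniqueness is proved among equilibria whose group statuses lie in [1/Z, Z], the range where S is constrained; without this restriction it can fail, since S'_x is arbitrary outside that range. Existence is of an equilibrium in this range. *)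

theory Defs
  imports "HOL-Analysis.Analysis"
begin

(* "Max" is unproblematic: the spectrum of a complex square matrix of positive size is
   finite and nonempty, and an index type is never empty. *)
definition max_eigenvalue_modulus :: "real ^ 'n ^ 'n \<Rightarrow> real" where
  "max_eigenvalue_modulus M =
     Max {cmod z | z. \<exists>v :: complex ^ 'n. v \<noteq> 0 \<and> (\<chi> i j. complex_of_real (M $ i $ j)) *v v = z *s v}"

datatype identity = Id_A | Id_B

fun other :: "identity \<Rightarrow> identity" where
  "other Id_A = Id_B"
| "other Id_B = Id_A"

definition members :: "('n \<Rightarrow> identity) \<Rightarrow> identity \<Rightarrow> 'n set" where
  "members \<theta> t = {k. \<theta> k = t}"

definition group_mean :: "('n::finite \<Rightarrow> identity) \<Rightarrow> ('n \<Rightarrow> real) \<Rightarrow> identity \<Rightarrow> real" where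
  "group_mean \<theta> f t = (\<Sum>k\<in>members \<theta> t. f k) / real (card (members \<theta> t))"

definition own_group_network :: "('n::finite \<Rightarrow> identity) \<Rightarrow> real ^ 'n ^ 'n \<Rightarrow> real ^ 'n ^ 'n" where
  "own_group_network \<theta> G = (\<chi> j k. if \<theta> j = \<theta> k then G $ j $ k else 0)"

definition weighted_network ::
  "real \<Rightarrow> ('n::finite \<Rightarrow> real) \<Rightarrow> ('n \<Rightarrow> identity) \<Rightarrow> real ^ 'n ^ 'n \<Rightarrow> real ^ 'n ^ 'n" where
  "weighted_network \<beta> w \<theta> G =
     (\<chi> j k. \<beta> * w j / (\<beta> * w j + 1) * own_group_network \<theta> G $ j $ k)"

definition centrality ::
  "real \<Rightarrow> ('n::finite \<Rightarrow> real) \<Rightarrow> ('n \<Rightarrow> identity) \<Rightarrow> real ^ 'n ^ 'n \<Rightarrow> 'n \<Rightarrow> real" where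
  "centrality \<beta> w \<theta> G j =
     (\<Sum>k\<in>UNIV. matrix_inv (mat 1 - weighted_network \<beta> w \<theta> G) $ j $ k * (w k / (\<beta> * w k + 1)))"

definition reference_point ::
  "('n::finite \<Rightarrow> identity) \<Rightarrow> real ^ 'n ^ 'n \<Rightarrow> ('n \<Rightarrow> real) \<Rightarrow> 'n \<Rightarrow> real" where
  "reference_point \<theta> G x j = (\<Sum>k\<in>members \<theta> (\<theta> j). G $ j $ k * x k)"

definition status :: "('n::finite \<Rightarrow> identity) \<Rightarrow> ('n \<Rightarrow> real) \<Rightarrow> identity \<Rightarrow> real" where
  "status \<theta> x t = group_mean \<theta> x t / group_mean \<theta> x (other t)"

(* The status level Y is an argument of its own rather than being computed from x, so that it
   can be held fixed when an agent contemplates a deviation. *)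
definition payoff ::
  "(real \<Rightarrow> real \<Rightarrow> real) \<Rightarrow> real \<Rightarrow> ('n::finite \<Rightarrow> real) \<Rightarrow> ('n \<Rightarrow> identity) \<Rightarrow> real ^ 'n ^ 'n \<Rightarrow>
    'n \<Rightarrow> real \<Rightarrow> ('n \<Rightarrow> real) \<Rightarrow> real" where
  "payoff S \<beta> w \<theta> G j Y x =
     S (x j) Y - 1 / 2 * \<beta> * (x j - reference_point \<theta> G x j)\<^sup>2 - 1 / (2 * w j) * (x j)\<^sup>2"

(* Positive group means are required so that both status ratios are defined (division by zero
   yields 0 in HOL). In the deviation x(j := y) the status stays at its value for x. *)
definition equilibrium ::
  "(real \<Rightarrow> real \<Rightarrow> real) \<Rightarrow> real \<Rightarrow> ('n::finite \<Rightarrow> real) \<Rightarrow> ('n \<Rightarrow> identity) \<Rightarrow> real ^ 'n ^ 'n \<Rightarrow>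
    ('n \<Rightarrow> real) \<Rightarrow> bool" where
  "equilibrium S \<beta> w \<theta> G x \<longleftrightarrow>
     (\<forall>j. 0 \<le> x j) \<and>
     (\<forall>t. 0 < group_mean \<theta> x t) \<and>
     (\<forall>j. \<forall>y\<ge>0. payoff S \<beta> w \<theta> G j (status \<theta> x (\<theta> j)) (x(j := y))
                 \<le> payoff S \<beta> w \<theta> G j (status \<theta> x (\<theta> j)) x)"

(* Sx, SY, Sxy are the derivatives S'_x, S'_Y, S''_xY. The constraint that S is linear in x is
   that S'_x does not depend on x >= 0. Only status levels in [1/Z, Z] are constrained, with
   one-sided derivatives at the ends of the domain. *)
definition status_utility ::
  "(real \<Rightarrow> real \<Rightarrow> real) \<Rightarrow> (real \<Rightarrow> real) \<Rightarrow> (real \<Rightarrow> real \<Rightarrow> real) \<Rightarrow> (real \<Rightarrow> real) \<Rightarrow>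
    real \<Rightarrow> real \<Rightarrow> bool" where
  "status_utility S Sx SY Sxy X Z \<longleftrightarrow>
     (\<forall>Y\<in>{1/Z..Z}. \<forall>x\<ge>0. ((\<lambda>x. S x Y) has_real_derivative Sx Y) (at x within {0..})) \<and>
     (\<forall>Y\<in>{1/Z..Z}. \<forall>x\<in>{0..X}. (S x has_real_derivative SY x Y) (at Y within {1/Z..Z})) \<and>
     (\<forall>Y\<in>{1/Z..Z}. (Sx has_real_derivative Sxy Y) (at Y within {1/Z..Z})) \<and>
     (\<forall>Y\<in>{1/Z..Z}. Sx Y > 0) \<and>
     (\<forall>Y\<in>{1/Z..Z}. \<forall>x\<in>{0..X}. SY x Y > 0) \<and>
     (\<forall>Y\<in>{1/Z..Z}. Sxy Y < 0)"

end

(*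
  By linearity of S in own consumption, best responses to fixed group statuses satisfy
  x = s b + H x with s_j = S'_x(Y_theta_j); since H does not link the two groups, this means
  x_j = s_j C_j. An equilibrium is therefore the same as a status Y = Y_A solving
  Y S'_x(1/Y) C_B - S'_x(Y) C_A = 0. The left-hand side is strictly increasing in Y and changes
  sign between 1 and C_A / C_B, both of which lie in [1/Z, Z] because 1/(1 + beta) <= C_j <= psi.

  Invertibility and monotonicity of I - H follow from a vector v > 0 with G v < v. It is found
  without Perron-Frobenius theory: the solution v_t of v_t = 1 + t G v_t depends continuously on t
  in [0, 1], and v_t >= 0 already forces v_t >= 1, so positivity propagates from t = 0 to t = 1.
*)
theory Submission
  imports Defs
begin

section \<open>Finiteness of the spectrum and bounds on real eigenvalues\<close>

text \<open>Induction on the number of terms: applying \<open>A - l x\<close> to a vanishing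
  combination removes the \<open>x\<close> term and multiplies each other coefficient by
  \<open>l y - l x\<close>, which is nonzero by injectivity of \<open>l\<close>.\<close>

lemma eigenvectors_independent:
  fixes A :: "'a::field ^ 'n ^ 'n"
  assumes eig: "\<And>x. x \<in> V \<Longrightarrow> A *v x = l x *s x"
    and nz: "0 \<notin> V" and inj: "inj_on l V"
  shows "vec.independent V"
  unfolding vec.independent_explicit_finite_subsets
proof (intro allI impI)
  fix S u assume "S \<subseteq> V" "finite S" and sum0: "(\<Sum>x\<in>S. u x *s x) = 0"
  have "finite S \<Longrightarrow> S \<subseteq> V \<Longrightarrow> (\<Sum>x\<in>S. u x *s x) = 0 \<Longrightarrow> \<forall>x\<in>S. u x = 0" for u
  proof (induction S arbitrary: u rule: finite_induct)
    case (insert x S)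
    have zero: "u x *s x + (\<Sum>y\<in>S. u y *s y) = 0"
      using insert by simp
    have "0 = A *v (u x *s x + (\<Sum>y\<in>S. u y *s y)) - l x *s (u x *s x + (\<Sum>y\<in>S. u y *s y))"
      unfolding zero by simp
    also have "\<dots> = (\<Sum>y\<in>S. u y *s (A *v y)) - (\<Sum>y\<in>S. l x *s (u y *s y))"
      using insert.prems
      by (simp add: vec.add vec.scale vec.sum eig vec.scale_right_distrib vec.scale_sum_right ac_simps)
    also have "\<dots> = (\<Sum>y\<in>S. (u y * (l y - l x)) *s y)"
      unfolding sum_subtractf[symmetric]
      by (rule sum.cong) (use insert.prems in \<open>auto simp: eig algebra_simps vec.scale_left_diff_distrib\<close>)
    finally have "\<forall>y\<in>S. u y * (l y - l x) = 0"
      using insert.IH[of "\<lambda>y. u y * (l y - l x)"] insert.prems by simp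
    moreover have "l y \<noteq> l x" if "y \<in> S" for y
      using insert.prems insert.hyps that inj by (auto dest!: inj_onD)
    ultimately have S: "\<forall>y\<in>S. u y = 0" by auto
    with zero have "u x *s x = 0" by simp
    moreover have "x \<noteq> 0" using nz insert.prems by auto
    ultimately show ?case using S by simp
  qed simp
  with \<open>S \<subseteq> V\<close> \<open>finite S\<close> sum0 show "\<forall>x\<in>S. u x = 0" by blast
qed

text \<open>One eigenvector chosen for each eigenvalue gives an independent set, and independent
  sets are finite here. This makes the \<open>Max\<close> in \<open>max_eigenvalue_modulus\<close>
  an actual upper bound.\<close>

lemma finite_eigenvalues:
  fixes A :: "'a::field ^ 'n ^ 'n"
  shows "finite {z. \<exists>v. v \<noteq> 0 \<and> A *v v = z *s v}" (is "finite ?E")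
proof -
  define v where "v z = (SOME v. v \<noteq> 0 \<and> A *v v = z *s v)" for z
  have v: "v z \<noteq> 0 \<and> A *v v z = z *s v z" if "z \<in> ?E" for z
    unfolding v_def by (rule someI_ex) (use that in simp)
  have "inj_on v ?E"
  proof (rule inj_onI)
    fix y z assume y: "y \<in> ?E" and z: "z \<in> ?E" and eq: "v y = v z"
    have "y *s v y = z *s v y"
      using v[OF y, THEN conjunct2] v[OF z, THEN conjunct2] unfolding eq by (rule trans[OF sym])
    then show "y = z" using v[OF y, THEN conjunct1] by (rule vec.scale_right_imp_eq[rotated])
  qed
  then have inv: "inv_into ?E v (v z) = z" if "z \<in> ?E" for z
    using that by (rule inv_into_f_f)
  have "vec.independent (v ` ?E)"
  proof (rule eigenvectors_independent[of _ _ "inv_into ?E v"])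
    show "A *v x = inv_into ?E v x *s x" if image: "x \<in> v ` ?E" for x
    proof -
      obtain z where x: "x = v z" and z: "z \<in> ?E" using image by (rule imageE)
      show ?thesis unfolding x inv[OF z] by (rule v[OF z, THEN conjunct2])
    qed
    show "0 \<notin> v ` ?E"
    proof
      assume "0 \<in> v ` ?E"
      then obtain z where z: "0 = v z" "z \<in> ?E" by (rule imageE)
      show False using v[OF z(2), THEN conjunct1] z(1)[symmetric] by (rule notE)
    qed
    show "inj_on (inv_into ?E v) (v ` ?E)" by (rule inj_on_inv_into) simp
  qed
  then have "finite (v ` ?E)" by (rule vec.finiteI_independent)
  with \<open>inj_on v ?E\<close> show ?thesis by (rule finite_imageD[rotated])
qed

text \<open>A real eigenvector is also an eigenvector of the complexified matrix. The spectral
  assumption on \<open>G\<close> enters through this bound.\<close>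

lemma cmod_eigenvalue_le:
  fixes G :: "real ^ 'n ^ 'n"
  assumes "G *v x = r *s x" "x \<noteq> 0"
  shows "\<bar>r\<bar> \<le> max_eigenvalue_modulus G"
proof -
  let ?A = "(\<chi> i j. complex_of_real (G $ i $ j)) :: complex ^ 'n ^ 'n"
  let ?x = "(\<chi> i. complex_of_real (x $ i)) :: complex ^ 'n"
  have "?A *v ?x = complex_of_real r *s ?x"
  proof (rule vec_eq_iff[THEN iffD2], intro allI)
    fix i
    have "(G *v x) $ i = r * x $ i" by (simp add: assms)
    then have "complex_of_real (\<Sum>j\<in>UNIV. G $ i $ j * x $ j) = complex_of_real (r * x $ i)"
      by (simp add: matrix_vector_mult_def)
    then show "(?A *v ?x) $ i = (complex_of_real r *s ?x) $ i"
      by (simp add: matrix_vector_mult_def)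
  qed
  moreover have "?x \<noteq> 0" using assms(2) by (auto simp: vec_eq_iff)
  ultimately have "\<bar>r\<bar> \<in> {cmod z | z. \<exists>v. v \<noteq> 0 \<and> ?A *v v = z *s v}"
    by (intro CollectI exI[of _ "complex_of_real r"]) auto
  moreover have "finite {cmod z | z. \<exists>v. v \<noteq> 0 \<and> ?A *v v = z *s v}"
    using finite_imageI[OF finite_eigenvalues[of ?A], of cmod] by (simp add: image_Collect)
  ultimately show ?thesis
    unfolding max_eigenvalue_modulus_def by (rule Max_ge[rotated])
qed

section \<open>A positive strict supersolution for \<open>G\<close>\<close>

lemma det_nonzero_if_trivial_kernel:
  fixes A :: "real ^ 'n ^ 'n"
  assumes "\<And>x. A *v x = 0 \<Longrightarrow> x = 0"
  shows "det A \<noteq> 0"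
  using assms by (metis invertible_det_nz invertible_left_inverse matrix_left_invertible_ker)

lemma continuous_on_det:
  fixes M :: "'a::topological_space \<Rightarrow> real ^ 'n ^ 'n"
  assumes "\<And>i j. continuous_on S (\<lambda>t. M t $ i $ j)"
  shows "continuous_on S (\<lambda>t. det (M t))"
  unfolding det_def by (intro continuous_intros assms)

lemma ex_strict_supersolution:
  fixes G :: "real ^ 'n ^ 'n"
  assumes nonneg: "\<And>j k. 0 \<le> G $ j $ k" and radius: "max_eigenvalue_modulus G < 1"
  obtains v where "\<And>j. 0 < v $ j" "\<And>j. (G *v v) $ j < v $ j"
proof -
  define M where "M t = mat 1 - t *\<^sub>R G" for t
  have M: "M t *v x = x - t *s (G *v x)" for t x
    by (simp add: M_def vec_eq_iff matrix_vector_mult_diff_rdistrib scaleR_matrix_vector_assoc[symmetric])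
  \<comment> \<open>A nonzero kernel vector of \<open>M t\<close> would be an eigenvector of
    \<open>G\<close> for the eigenvalue \<open>1 / t\<close>, which is at least 1.\<close>
  have detM: "det (M t) \<noteq> 0" if t: "t \<in> {0..1}" for t
  proof (rule det_nonzero_if_trivial_kernel, rule ccontr)
    fix x assume "M t *v x = 0" "x \<noteq> 0"
    then have eq: "x = t *s (G *v x)" and "t \<noteq> 0" by (auto simp: M)
    then have "G *v x = (1 / t) *s x"
      by (metis (no_types) vec.scale_scale vec.scale_one divide_self_if times_divide_eq_left mult_1)
    then have "\<bar>1 / t\<bar> \<le> max_eigenvalue_modulus G" using \<open>x \<noteq> 0\<close> by (rule cmod_eigenvalue_le)
    moreover have "1 \<le> \<bar>1 / t\<bar>" using t \<open>t \<noteq> 0\<close> by simp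
    ultimately show False using radius by simp
  qed
  \<comment> \<open>Cramer's rule writes the solution of \<open>M t *v x = 1\<close> as quotients of
    determinants, so continuity in \<open>t\<close> can be read off.\<close>
  define v where "v t = (\<chi> k. det (\<chi> i j. if j = k then (1 :: real ^ 'n) $ i else M t $ i $ j) / det (M t))" for t
  have v: "v t = 1 + t *s (G *v v t)" if t: "t \<in> {0..1}" for t
  proof -
    have "M t *v v t = 1"
      using cramer[OF detM[OF t], of "v t" 1] by (simp add: v_def)
    then show ?thesis by (simp add: M algebra_simps)
  qed
  have "continuous_on {0..1} (\<lambda>t. M t $ i $ j)" for i j
    unfolding M_def by (simp, intro continuous_intros)
  then have "continuous_on {0..1} (\<lambda>t. if j = k then (1 :: real ^ 'n) $ i else M t $ i $ j)"
    and "continuous_on {0..1} (\<lambda>t. M t $ i $ j)" for i j k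
    by (cases "j = k"; simp)+
  then have cont: "continuous_on {0..1} v"
    unfolding v_def using detM
    by (intro continuous_on_vec_lambda continuous_on_divide continuous_on_det) simp_all
  define T where "T = {t \<in> {0..1}. \<forall>k. 0 < v t $ k}"
  \<comment> \<open>Two descriptions of one set: the strict inequalities make it relatively open,
    the weak ones relatively closed.\<close>
  have T': "T = {t \<in> {0..1}. \<forall>k. 0 \<le> v t $ k}"
  proof -
    have "1 \<le> v t $ k" if "t \<in> {0..1}" "\<forall>k. 0 \<le> v t $ k" for t k
    proof -
      have "v t $ k = 1 + t * (\<Sum>i\<in>UNIV. G $ k $ i * v t $ i)"
        using arg_cong[OF v[OF that(1)], of "\<lambda>x. x $ k"] by (simp add: matrix_vector_mult_def)
      then show ?thesis using that nonneg by (simp add: sum_nonneg)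
    qed
    then show ?thesis
      unfolding T_def by (intro Collect_cong) (meson less_imp_le less_le_trans zero_less_one)
  qed
  have "openin (top_of_set {0..1}) T"
  proof -
    have "open (\<Inter>k. {x :: real ^ 'n. 0 < x $ k})"
      by (intro open_INT ballI open_Collect_less continuous_intros) auto
    from continuous_openin_preimage_gen[OF cont this] show ?thesis
      by (rule back_subst[of "openin _"]) (auto simp: T_def)
  qed
  moreover have "closedin (top_of_set {0..1}) T"
  proof -
    have "closed (\<Inter>k. {x :: real ^ 'n. 0 \<le> x $ k})"
      by (intro closed_INT ballI closed_Collect_le continuous_intros)
    from continuous_closedin_preimage[OF cont this] show ?thesis
      by (rule back_subst[of "closedin _"]) (auto simp: T')
  qed
  moreover have "0 \<in> T" using v[of 0] by (simp add: T_def)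
  moreover have "connected {0..1::real}" by simp
  ultimately have "T = {0..1}" unfolding connected_clopen by blast
  then have "1 \<in> T" by simp
  show thesis
  proof
    show "0 < v 1 $ j" for j using \<open>1 \<in> T\<close> by (simp add: T_def)
    show "(G *v v 1) $ j < v 1 $ j" for j
      using arg_cong[OF v[of 1], of "\<lambda>x. x $ j"] by simp
  qed
qed

section \<open>Maximum principle and resolvent of a nonnegative matrix\<close>

text \<open>A discrete maximum principle. Let \<open>i\<close> minimize the ratio
  \<open>q k = x $ k / v $ k\<close>. If \<open>q i\<close> were negative, then \<open>q i * v $ i <
  q i * (H *v v) $ i \<le> (H *v x) $ i \<le> x $ i = q i * v $ i\<close>.\<close>

lemma supersolution_nonneg:
  fixes H :: "real ^ 'n ^ 'n"
  assumes nonneg: "\<And>j k. 0 \<le> H $ j $ k"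
    and v: "\<And>j. 0 < v $ j" "\<And>j. (H *v v) $ j < v $ j"
    and x: "\<And>j. (H *v x) $ j \<le> x $ j"
  shows "0 \<le> x $ j"
proof -
  define q where "q k = x $ k / v $ k" for k
  have "Min (range q) \<in> range q" by (rule Min_in) auto
  then obtain i where i: "q i = Min (range q)" by (metis imageE)
  have le: "q i * v $ k \<le> x $ k" for k
  proof -
    have "q i \<le> q k" unfolding i by simp
    then show ?thesis using v(1)[of k] by (simp add: q_def pos_le_divide_eq)
  qed
  have "0 \<le> q i"
  proof (rule ccontr)
    assume neg: "\<not> 0 \<le> q i"
    have "q i * v $ i < q i * (H *v v) $ i"
      using neg v(2) by (simp add: mult_strict_left_mono_neg)
    also have "\<dots> = (\<Sum>k\<in>UNIV. H $ i $ k * (q i * v $ k))"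
      by (simp add: matrix_vector_mult_def sum_distrib_left ac_simps)
    also have "\<dots> \<le> (\<Sum>k\<in>UNIV. H $ i $ k * x $ k)"
      by (intro sum_mono mult_left_mono le nonneg)
    also have "\<dots> \<le> x $ i" using x[of i] by (simp add: matrix_vector_mult_def)
    also have "\<dots> = q i * v $ i" using v(1)[of i] by (simp add: q_def)
    finally show False by simp
  qed
  then show ?thesis
    using le[of j] v(1)[of j] by (meson mult_nonneg_nonneg less_imp_le order_trans)
qed


text \<open>If \<open>y\<close> is in the kernel of \<open>mat 1 - H\<close>, then \<open>y\<close>
  and \<open>- y\<close> are both fixed by \<open>H\<close>, so both are nonnegative by the maximum
  principle and \<open>y = 0\<close>. Hence \<open>mat 1 - H\<close> is invertible.\<close>

lemma strict_supersolution_resolvent: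
  fixes H :: "real ^ 'n ^ 'n"
  assumes nonneg: "\<And>j k. 0 \<le> H $ j $ k"
    and v: "\<And>j. 0 < v $ j" "\<And>j. (H *v v) $ j < v $ j"
  shows "x = b + H *v x \<longleftrightarrow> x = matrix_inv (mat 1 - H) *v b"
proof -
  let ?A = "mat 1 - H"
  have "y = 0" if "?A *v y = 0" for y
  proof -
    have "H *v y = y" using that by (simp add: matrix_vector_mult_diff_rdistrib)
    moreover from this have "H *v (- y) = - y" by (simp add: vec.neg)
    ultimately have "0 \<le> y $ j" "0 \<le> (- y) $ j" for j
      by (intro supersolution_nonneg[OF nonneg v]; simp)+
    then show ?thesis by (simp add: vec_eq_iff order.antisym)
  qed
  then have "invertible ?A"
    using det_nonzero_if_trivial_kernel invertible_det_nz by blast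
  then have inv: "?A ** matrix_inv ?A = mat 1" "matrix_inv ?A ** ?A = mat 1"
    unfolding invertible_def matrix_inv_def by (rule someI2_ex; simp)+
  have "x = b + H *v x \<longleftrightarrow> ?A *v x = b"
    by (auto simp: matrix_vector_mult_diff_rdistrib algebra_simps)
  also have "\<dots> \<longleftrightarrow> x = matrix_inv ?A *v b"
    by (metis inv matrix_vector_mul_assoc matrix_vector_mul_lid)
  finally show ?thesis .
qed

section \<open>The weighted network and centrality\<close>

lemma weighted_network_nonneg:
  assumes "\<And>j. 1 \<le> w j" "0 < \<beta>" "\<And>j k. 0 \<le> G $ j $ k"
  shows "0 \<le> weighted_network \<beta> w \<theta> G $ j $ k"
proof -
  have "0 \<le> w j" using assms(1)[of j] by linarith
  then show ?thesis
    using assms by (simp add: weighted_network_def own_group_network_def)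
qed

lemma weighted_network_le:
  assumes "\<And>j. 1 \<le> w j" "0 < \<beta>" "\<And>j k. 0 \<le> G $ j $ k"
  shows "weighted_network \<beta> w \<theta> G $ j $ k \<le> G $ j $ k"
proof -
  have "0 \<le> w j" using assms(1)[of j] by linarith
  then have "\<beta> * w j / (\<beta> * w j + 1) \<le> 1" "0 \<le> \<beta> * w j / (\<beta> * w j + 1)"
    using assms(2) by (auto simp: divide_le_eq_1 intro: add_nonneg_pos)
  then show ?thesis
    using assms mult_right_mono[of "\<beta> * w j / (\<beta> * w j + 1)" 1 "G $ j $ k"]
    by (auto simp: weighted_network_def own_group_network_def)
qed

text \<open>Entrywise \<open>H\<close> lies between 0 and \<open>G\<close>, so a positive
  \<open>v\<close> with \<open>G *v v < v\<close> in each coordinate is a strict supersolution for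
  \<open>H\<close> too.\<close>

lemma weighted_network_resolvent:
  fixes G :: "real ^ 'n ^ 'n" and \<theta> :: "'n \<Rightarrow> identity"
  assumes w: "\<And>j. 1 \<le> w j" and G: "\<And>j k. 0 \<le> G $ j $ k"
    and radius: "max_eigenvalue_modulus G < 1" and \<beta>: "0 < \<beta>"
  defines "H \<equiv> weighted_network \<beta> w \<theta> G"
  shows weighted_network_fixed_point: "x = b + H *v x \<longleftrightarrow> x = matrix_inv (mat 1 - H) *v b"
    and weighted_network_fixed_point_nonneg:
      "(\<And>j. 0 \<le> b $ j) \<Longrightarrow> x = b + H *v x \<Longrightarrow> 0 \<le> x $ j"
proof -
  obtain v where v: "\<And>j. 0 < v $ j" "\<And>j. (G *v v) $ j < v $ j"
    using ex_strict_supersolution[OF G radius] by blast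
  have H: "0 \<le> H $ j $ k" for j k
    unfolding H_def by (rule weighted_network_nonneg[OF w \<beta> G])
  have "(H *v v) $ j \<le> (G *v v) $ j" for j
    unfolding matrix_vector_mult_def H_def
    by (simp, intro sum_mono mult_right_mono weighted_network_le[OF w \<beta> G] less_imp_le[OF v(1)])
  then have Hv: "(H *v v) $ j < v $ j" for j
    using v(2)[of j] by (meson le_less_trans)
  show "x = b + H *v x \<longleftrightarrow> x = matrix_inv (mat 1 - H) *v b"
    by (rule strict_supersolution_resolvent[OF H v(1) Hv])
  show "0 \<le> x $ j" if b: "\<And>j. 0 \<le> b $ j" and x: "x = b + H *v x"
  proof (rule supersolution_nonneg[OF H v(1) Hv])
    show "(H *v x) $ k \<le> x $ k" for k
      using arg_cong[OF x, of "\<lambda>y. y $ k"] b[of k] by simp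
  qed
qed

text \<open>The resolvent formula defining centrality, turned back into the linear system C = b + H
  C.\<close>

lemma centrality_fixed_point:
  fixes G :: "real ^ 'n ^ 'n"
  assumes w: "\<And>j. 1 \<le> w j" and G: "\<And>j k. 0 \<le> G $ j $ k"
    and radius: "max_eigenvalue_modulus G < 1" and \<beta>: "0 < \<beta>"
  shows "centrality \<beta> w \<theta> G j =
    w j / (\<beta> * w j + 1) + (\<Sum>k\<in>UNIV. weighted_network \<beta> w \<theta> G $ j $ k * centrality \<beta> w \<theta> G k)"
proof -
  let ?H = "weighted_network \<beta> w \<theta> G" and ?b = "\<chi> k. w k / (\<beta> * w k + 1)"
  have "(\<chi> k. centrality \<beta> w \<theta> G k) = matrix_inv (mat 1 - ?H) *v ?b"
    by (simp add: vec_eq_iff centrality_def matrix_vector_mult_def)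
  then have "(\<chi> k. centrality \<beta> w \<theta> G k) = ?b + ?H *v (\<chi> k. centrality \<beta> w \<theta> G k)"
    by (rule weighted_network_fixed_point[OF w G radius \<beta>, THEN iffD2])
  from arg_cong[OF this, of "\<lambda>y. y $ j"] show ?thesis
    by (simp add: matrix_vector_mult_def)
qed

text \<open>Since C = b + H C with b and H nonnegative, C is nonnegative and hence at least b. The
  entry w / (\<beta> w + 1) of b increases in w and equals 1 / (1 + \<beta>) at w = 1.\<close>

lemma centrality_lower_bound:
  fixes G :: "real ^ 'n ^ 'n"
  assumes w: "\<And>j. 1 \<le> w j" and G: "\<And>j k. 0 \<le> G $ j $ k"
    and radius: "max_eigenvalue_modulus G < 1" and \<beta>: "0 < \<beta>"
  shows "1 / (1 + \<beta>) \<le> centrality \<beta> w \<theta> G j"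
proof -
  let ?H = "weighted_network \<beta> w \<theta> G" and ?b = "\<chi> k. w k / (\<beta> * w k + 1)"
  let ?C = "\<chi> k. centrality \<beta> w \<theta> G k"
  have w0: "0 < w k" for k using w[of k] by linarith
  have "?C = ?b + ?H *v ?C"
    by (simp add: vec_eq_iff matrix_vector_mult_def)
       (intro allI centrality_fixed_point[OF w G radius \<beta>])
  then have "0 \<le> ?C $ k" for k
    by (rule weighted_network_fixed_point_nonneg[OF w G radius \<beta>, rotated])
       (use w0 \<beta> in \<open>simp add: less_imp_le add_nonneg_nonneg\<close>)
  then have "0 \<le> (\<Sum>k\<in>UNIV. ?H $ j $ k * centrality \<beta> w \<theta> G k)"
    by (intro sum_nonneg mult_nonneg_nonneg weighted_network_nonneg[OF w \<beta> G]) simp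
  then have "w j / (\<beta> * w j + 1) \<le> centrality \<beta> w \<theta> G j"
    using centrality_fixed_point[where w = w and \<theta> = \<theta> and j = j, OF w G radius \<beta>] by linarith
  moreover have "1 / (1 + \<beta>) \<le> w j / (\<beta> * w j + 1)"
    using w[of j] w0[of j] \<beta> by (simp add: divide_le_eq le_divide_eq add_pos_pos field_simps)
  ultimately show ?thesis by linarith
qed

text \<open>H has no entries between the groups, so it commutes with scaling by a factor that is
  constant on each group. Scaled centrality thus solves the scaled system, and the resolvent gives
  uniqueness.\<close>

lemma group_scaled_fixed_point:
  fixes G :: "real ^ 'n ^ 'n"
  assumes w: "\<And>j. 1 \<le> w j" and G: "\<And>j k. 0 \<le> G $ j $ k"
    and radius: "max_eigenvalue_modulus G < 1" and \<beta>: "0 < \<beta>"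
  shows "(\<forall>j. x j = s (\<theta> j) * (w j / (\<beta> * w j + 1)) +
              (\<Sum>k\<in>UNIV. weighted_network \<beta> w \<theta> G $ j $ k * x k))
    \<longleftrightarrow> (\<forall>j. x j = s (\<theta> j) * centrality \<beta> w \<theta> G j)" (is "?fix x \<longleftrightarrow> ?sol")
proof -
  let ?H = "weighted_network \<beta> w \<theta> G" and ?C = "centrality \<beta> w \<theta> G"
  let ?b = "\<chi> j. s (\<theta> j) * (w j / (\<beta> * w j + 1))"
  have fix_iff: "?fix y \<longleftrightarrow> (\<chi> j. y j) = matrix_inv (mat 1 - ?H) *v ?b" for y
    unfolding weighted_network_fixed_point[OF w G radius \<beta>, symmetric]
    by (simp add: vec_eq_iff matrix_vector_mult_def)
  have "?fix (\<lambda>j. s (\<theta> j) * ?C j)"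
  proof
    fix j
    have "s (\<theta> j) * ?C j = s (\<theta> j) * (w j / (\<beta> * w j + 1)) + (\<Sum>k\<in>UNIV. s (\<theta> j) * (?H $ j $ k * ?C k))"
      by (subst centrality_fixed_point[OF w G radius \<beta>]) (simp add: distrib_left sum_distrib_left)
    \<comment> \<open>Terms with \<open>\<theta> k \<noteq> \<theta> j\<close> vanish on both
      sides.\<close>
    also have "(\<Sum>k\<in>UNIV. s (\<theta> j) * (?H $ j $ k * ?C k)) = (\<Sum>k\<in>UNIV. ?H $ j $ k * (s (\<theta> k) * ?C k))"
      by (intro sum.cong) (auto simp: weighted_network_def own_group_network_def)
    finally show "s (\<theta> j) * ?C j = s (\<theta> j) * (w j / (\<beta> * w j + 1)) + (\<Sum>k\<in>UNIV. ?H $ j $ k * (s (\<theta> k) * ?C k))" .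
  qed
  then show ?thesis
    unfolding fix_iff[of "\<lambda>j. s (\<theta> j) * ?C j"] fix_iff[of x] by (simp add: vec_eq_iff)
qed

section \<open>Reference points and the quadratic maximization problem\<close>

lemma reference_point_alt:
  "reference_point \<theta> G x j = (\<Sum>k\<in>UNIV. own_group_network \<theta> G $ j $ k * x k)"
  unfolding reference_point_def
  by (rule sum.mono_neutral_cong_left) (auto simp: members_def own_group_network_def)

text \<open>The zero diagonal keeps an agent's own consumption out of her reference point, so a
  deviation leaves it fixed.\<close>

lemma reference_point_update:
  assumes "G $ j $ j = 0"
  shows "reference_point \<theta> G (x(j := y)) j = reference_point \<theta> G x j"
  unfolding reference_point_def by (rule sum.cong) (use assms in auto)

text \<open>Completing the square: the objective is its value at \<open>y0\<close> minus
  \<open>c * (z - y0)\<^sup>2\<close> with \<open>c > 0\<close>. The vertex \<open>y0\<close> is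
  nonnegative because \<open>a\<close> and \<open>R\<close> are, so it is feasible.\<close>

lemma quadratic_argmax_iff:
  fixes a R \<beta> w y :: real
  assumes w: "1 \<le> w" and \<beta>: "0 < \<beta>" and a: "0 < a" and R: "0 \<le> R"
  shows "0 \<le> y \<and> (\<forall>z\<ge>0. a * z - 1 / 2 * \<beta> * (z - R)\<^sup>2 - 1 / (2 * w) * z\<^sup>2
                        \<le> a * y - 1 / 2 * \<beta> * (y - R)\<^sup>2 - 1 / (2 * w) * y\<^sup>2)
    \<longleftrightarrow> y = (a + \<beta> * R) * (w / (\<beta> * w + 1))"
proof -
  define y0 where "y0 = (a + \<beta> * R) * (w / (\<beta> * w + 1))"
  define c where "c = (\<beta> + 1 / w) / 2"
  let ?f = "\<lambda>z. a * z - 1 / 2 * \<beta> * (z - R)\<^sup>2 - 1 / (2 * w) * z\<^sup>2"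
  have pos: "0 < \<beta> * w + 1" using w \<beta> by (simp add: add_pos_pos)
  have c: "0 < c" using w \<beta> by (simp add: c_def add_pos_pos)
  have y0: "0 \<le> y0" using w \<beta> a R pos by (simp add: y0_def)
  have "2 * c = (\<beta> * w + 1) / w" using w by (simp add: c_def field_simps)
  then have "2 * c * y0 = a + \<beta> * R" using w pos by (simp add: y0_def)
  then have lin: "a = 2 * c * y0 - \<beta> * R" by simp
  have f: "?f z = ?f y0 - c * (z - y0)\<^sup>2" for z
    unfolding lin using w by (simp add: c_def power2_eq_square field_simps)
  show ?thesis unfolding y0_def[symmetric]
  proof
    assume *: "0 \<le> y \<and> (\<forall>z\<ge>0. ?f z \<le> ?f y)"
    then have "?f y0 \<le> ?f y" using y0 by blast
    then have "c * (y - y0)\<^sup>2 \<le> 0" using f[of y] by linarith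
    then have "(y - y0)\<^sup>2 \<le> 0" using c by (simp add: mult_le_0_iff)
    then show "y = y0" by simp
  next
    assume "y = y0"
    moreover have "?f z \<le> ?f y0" for z
      using f[of z] c by simp
    ultimately show "0 \<le> y \<and> (\<forall>z\<ge>0. ?f z \<le> ?f y)" using y0 by blast
  qed
qed

section \<open>Shape of the status utility and the status equation\<close>

text \<open>The difference \<open>S x Y - Sx Y * x\<close> has derivative zero on the convex
  half-line, hence is constant in \<open>x\<close>.\<close>

lemma status_utility_linear:
  assumes "status_utility S Sx SY Sxy X Z" "Y \<in> {1/Z..Z}" "0 \<le> x"
  shows "S x Y = S 0 Y + Sx Y * x"
proof -
  have "\<exists>c. \<forall>x\<in>{0..}. S x Y - Sx Y * x = c"
  proof (rule has_field_derivative_zero_constant)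
    show "((\<lambda>x. S x Y - Sx Y * x) has_real_derivative 0) (at x within {0..})" if "x \<in> {0..}" for x
      using assms that unfolding status_utility_def by (auto intro!: derivative_eq_intros)
  qed simp
  then have "S x Y - Sx Y * x = S 0 Y - Sx Y * 0" using assms(3) by force
  then show ?thesis by simp
qed

lemma status_utility_pos:
  assumes "status_utility S Sx SY Sxy X Z" "Y \<in> {1/Z..Z}"
  shows "0 < Sx Y"
  using assms by (auto simp: status_utility_def)

lemma status_utility_continuous:
  assumes "status_utility S Sx SY Sxy X Z"
  shows "continuous_on {1/Z..Z} Sx"
  using assms unfolding status_utility_def by (intro DERIV_continuous_on) blast

lemma status_utility_antimono:
  assumes U: "status_utility S Sx SY Sxy X Z" and "a \<in> {1/Z..Z}" "b \<in> {1/Z..Z}" "a < b"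
  shows "Sx b < Sx a"
proof (rule DERIV_neg_imp_decreasing_open[OF \<open>a < b\<close>])
  show "continuous_on {a..b} Sx"
    using status_utility_continuous[OF U] by (rule continuous_on_subset) (use assms in auto)
  fix x assume x: "a < x" "x < b"
  then have "1 / Z < x" "x < Z" using assms by auto
  \<comment> \<open>At interior points the derivative within the interval is the two-sided one;
    continuity takes care of the end points.\<close>
  then show "\<exists>y. (Sx has_real_derivative y) (at x) \<and> y < 0"
    using U unfolding status_utility_def by (metis at_within_Icc_at atLeastAtMost_iff less_imp_le)
qed

text \<open>Here \<open>a\<close> and \<open>b\<close> stand for the mean centralities of the two
  groups. The equation is cleared of its positive denominator and becomes \<open>f Y = 0\<close>;
  strict monotonicity gives uniqueness, the intermediate value theorem existence.\<close>

lemma status_equation_unique_solution: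
  fixes a b Z :: real
  assumes U: "status_utility S Sx SY Sxy X Z"
    and ab: "0 < a" "0 < b" and Z: "a / b \<in> {1/Z..Z}" "1 \<le> Z"
  shows "\<exists>!Y. Y \<in> {1/Z..Z} \<and> Y = Sx Y * a / (Sx (1 / Y) * b)"
proof -
  define f where "f Y = Y * Sx (1 / Y) * b - Sx Y * a" for Y
  let ?I = "{1/Z..Z}"
  have I_pos: "0 < Y" if "Y \<in> ?I" for Y
    using that Z(2) by (auto intro: less_le_trans[of 0 "1/Z"])
  \<comment> \<open>The interval is symmetric under inversion, so the assumptions on
    \<open>Sx\<close> apply at \<open>Y\<close> and at \<open>1 / Y\<close>.\<close>
  have I_inv: "1 / Y \<in> ?I" if "Y \<in> ?I" for Y
    using that I_pos[OF that] Z(2) by (auto simp: field_simps)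
  have f0: "Y = Sx Y * a / (Sx (1 / Y) * b) \<longleftrightarrow> f Y = 0" if "Y \<in> ?I" for Y
    using status_utility_pos[OF U I_inv[OF that]] ab by (auto simp: f_def field_simps)
  have cont: "continuous_on ?I f"
    unfolding f_def
    by (intro continuous_intros continuous_on_compose2[OF status_utility_continuous[OF U]]
          status_utility_continuous[OF U]) (use I_inv I_pos in force)+
  have mono: "f x < f y" if "x \<in> ?I" "y \<in> ?I" "x < y" for x y
  proof -
    have "Sx (1 / x) < Sx (1 / y)"
      using that I_pos by (intro status_utility_antimono[OF U] I_inv divide_strict_left_mono) auto
    then have "x * Sx (1 / x) * b < y * Sx (1 / y) * b"
      using that I_pos status_utility_pos[OF U I_inv] ab
      by (intro mult_strict_right_mono mult_strict_mono') (auto simp: less_imp_le)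
    moreover have "Sx y * a < Sx x * a"
      using status_utility_antimono[OF U that] ab by simp
    ultimately show ?thesis by (simp add: f_def)
  qed
  \<comment> \<open>The signs at the two bracketing points: if \<open>a \<ge> b\<close>, then
    \<open>f 1 \<le> 0\<close>, and \<open>1 / (a / b) \<le> a / b\<close> with \<open>Sx\<close>
    decreasing gives \<open>f (a / b) \<ge> 0\<close>. For \<open>a < b\<close> both signs
    flip.\<close>
  have L: "f (a / b) = a * (Sx (1 / (a / b)) - Sx (a / b))" "f 1 = Sx 1 * (b - a)"
    using ab by (auto simp: f_def field_simps)
  have one: "1 \<in> ?I" using Z(2) by simp
  have "\<exists>Y\<in>?I. f Y = 0"
  proof (cases "1 \<le> a / b")
    case True
    then have "1 / (a / b) \<le> 1" using ab by simp
    with True have "1 / (a / b) \<le> a / b" by linarith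
    then have "Sx (a / b) \<le> Sx (1 / (a / b))"
      using status_utility_antimono[OF U I_inv[OF Z(1)] Z(1)] by (cases "1 / (a / b) = a / b") auto
    then have "0 \<le> f (a / b)" "f 1 \<le> 0"
      using True ab status_utility_pos[OF U one] by (auto simp: L mult_le_0_iff field_simps)
    moreover have "continuous_on {1..a/b} f"
      using cont by (rule continuous_on_subset) (use one Z in auto)
    ultimately obtain Y where Y: "1 \<le> Y" "Y \<le> a / b" "f Y = 0"
      using IVT'[of f 1 0 "a / b"] True by blast
    then have "Y \<in> ?I" using one Z unfolding atLeastAtMost_iff by linarith
    with Y show ?thesis by blast
  next
    case False
    then have "a / b \<le> 1" "1 \<le> 1 / (a / b)" using ab by simp_all
    then have "a / b \<le> 1 / (a / b)" by linarith
    then have "Sx (1 / (a / b)) \<le> Sx (a / b)"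
      using status_utility_antimono[OF U Z(1) I_inv[OF Z(1)]] by (cases "1 / (a / b) = a / b") auto
    then have "f (a / b) \<le> 0" "0 \<le> f 1"
      using False ab status_utility_pos[OF U one] by (auto simp: L mult_le_0_iff field_simps)
    moreover have "continuous_on {a/b..1} f"
      using cont by (rule continuous_on_subset) (use one Z in auto)
    ultimately obtain Y where Y: "a / b \<le> Y" "Y \<le> 1" "f Y = 0"
      using IVT'[of f "a / b" 0 1] False by auto
    then have "Y \<in> ?I" using one Z unfolding atLeastAtMost_iff by linarith
    with Y show ?thesis by blast
  qed
  moreover have "x = y" if "x \<in> ?I" "y \<in> ?I" "f x = 0" "f y = 0" for x y
    using mono[of x y] mono[of y x] that by (cases x y rule: linorder_cases) auto
  ultimately show ?thesis using f0 by metis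
qed


section \<open>Best responses at fixed status\<close>

text \<open>Status and reference point stay fixed, so the payoff is quadratic in \<open>y\<close>.
  The term \<open>S 0 Y\<close> is split off because it cancels in comparisons.\<close>

lemma payoff_deviation:
  assumes U: "status_utility S Sx SY Sxy X Z" and Y: "Y \<in> {1/Z..Z}" and "G $ j $ j = 0" and "0 \<le> y"
  shows "payoff S \<beta> w \<theta> G j Y (x(j := y)) = S 0 Y + (Sx Y * y
    - 1 / 2 * \<beta> * (y - reference_point \<theta> G x j)\<^sup>2 - 1 / (2 * w j) * y\<^sup>2)"
  using status_utility_linear[OF U Y \<open>0 \<le> y\<close>]
  by (simp add: payoff_def reference_point_update[of G, OF \<open>G $ j $ j = 0\<close>])

text \<open>The vertex of the quadratic is
  \<open>(Sx Y + \<beta> * R) * (w j / (\<beta> * w j + 1))\<close>, and its part in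
  \<open>R\<close> is row \<open>j\<close> of the weighted network applied to
  \<open>x\<close>.\<close>

lemma best_response_iff:
  assumes U: "status_utility S Sx SY Sxy X Z" and Y: "Y \<in> {1/Z..Z}" and diag: "G $ j $ j = 0"
    and w: "1 \<le> w j" and \<beta>: "0 < \<beta>" and G: "\<And>j k. 0 \<le> G $ j $ k" and x: "\<And>k. 0 \<le> x k"
  shows "(\<forall>y\<ge>0. payoff S \<beta> w \<theta> G j Y (x(j := y)) \<le> payoff S \<beta> w \<theta> G j Y x) \<longleftrightarrow>
    x j = Sx Y * (w j / (\<beta> * w j + 1)) + (\<Sum>k\<in>UNIV. weighted_network \<beta> w \<theta> G $ j $ k * x k)"
proof -
  let ?R = "reference_point \<theta> G x j"
  have R: "0 \<le> ?R"
    unfolding reference_point_def by (intro sum_nonneg mult_nonneg_nonneg G x)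
  have H: "(\<Sum>k\<in>UNIV. weighted_network \<beta> w \<theta> G $ j $ k * x k) = \<beta> * ?R * (w j / (\<beta> * w j + 1))"
    unfolding reference_point_alt by (simp add: weighted_network_def sum_distrib_left sum_distrib_right ac_simps)
  \<comment> \<open>Writing \<open>x\<close> as the trivial deviation brings both sides of the
    comparison into the same quadratic form.\<close>
  have "payoff S \<beta> w \<theta> G j Y x = payoff S \<beta> w \<theta> G j Y (x(j := x j))" by simp
  also note payoff_deviation[OF U Y diag x]
  finally have "(\<forall>y\<ge>0. payoff S \<beta> w \<theta> G j Y (x(j := y)) \<le> payoff S \<beta> w \<theta> G j Y x) \<longleftrightarrow>
    0 \<le> x j \<and> (\<forall>y\<ge>0. Sx Y * y - 1 / 2 * \<beta> * (y - ?R)\<^sup>2 - 1 / (2 * w j) * y\<^sup>2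
      \<le> Sx Y * x j - 1 / 2 * \<beta> * (x j - ?R)\<^sup>2 - 1 / (2 * w j) * (x j)\<^sup>2)"
    using x by (simp add: payoff_deviation[where G = G and j = j, OF U Y diag])
  also have "\<dots> \<longleftrightarrow> x j = (Sx Y + \<beta> * ?R) * (w j / (\<beta> * w j + 1))"
    by (rule quadratic_argmax_iff[OF w \<beta> status_utility_pos[OF U Y] R])
  finally show ?thesis unfolding H by (simp only: distrib_right)
qed

section \<open>Group means and statuses\<close>

lemma other_other [simp]: "other (other t) = t"
  by (cases t) auto

lemma group_mean_scaled:
  "group_mean \<theta> (\<lambda>j. s (\<theta> j) * f j) t = s t * group_mean \<theta> f t"
  unfolding group_mean_def
  by (simp add: members_def sum_distrib_left)

lemma group_mean_bounds:
  assumes "members \<theta> t \<noteq> {}" "\<And>j. l \<le> f j" "\<And>j. f j \<le> u"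
  shows "l \<le> group_mean \<theta> f t" "group_mean \<theta> f t \<le> u"
proof -
  have "0 < card (members \<theta> t)" using assms(1) by (simp add: card_gt_0_iff)
  then show "l \<le> group_mean \<theta> f t" "group_mean \<theta> f t \<le> u"
    using sum_bounded_below[of "members \<theta> t" l f] sum_bounded_above[of "members \<theta> t" f u] assms
    by (simp_all add: group_mean_def pos_le_divide_eq pos_divide_le_eq ac_simps)
qed

text \<open>If a group mean is zero, both sides are 0 by the convention for division by
  zero.\<close>

lemma status_other: "status \<theta> x (other t) = 1 / status \<theta> x t"
  by (simp add: status_def)

section \<open>Equilibria as solutions of the status equation\<close>

theorem proposition1:
  fixes G :: "real ^ 'n ^ 'n" and w :: "'n \<Rightarrow> real" and \<theta> :: "'n \<Rightarrow> identity"
    and \<beta> X Z \<psi> \<rho> :: real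
    and S SY :: "real \<Rightarrow> real \<Rightarrow> real" and Sx Sxy :: "real \<Rightarrow> real"
  assumes income: "\<And>j. 1 \<le> w j"
    and groups_nonempty: "\<And>t. members \<theta> t \<noteq> {}"
    and G_nonneg: "\<And>j k. 0 \<le> G $ j $ k"
    and G_diag: "\<And>j. G $ j $ j = 0"
    and G_radius: "max_eigenvalue_modulus G < 1"
    and \<beta>_pos: "0 < \<beta>"
    and \<psi>: "\<psi> = Max (range (centrality \<beta> w \<theta> G))"
    and \<rho>: "\<rho> = Sx (1 / (\<psi> * (1 + \<beta>)))"
    and X: "X \<ge> \<psi> * \<rho>"
    and Z: "Z \<ge> \<psi> * (1 + \<beta>)"
    and utility: "status_utility S Sx SY Sxy X Z"
  shows "(\<exists>!x. equilibrium S \<beta> w \<theta> G x \<and> (\<forall>t. status \<theta> x t \<in> {1/Z..Z})) \<and>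
         (\<forall>x. equilibrium S \<beta> w \<theta> G x \<and> (\<forall>t. status \<theta> x t \<in> {1/Z..Z}) \<longrightarrow>
           (\<forall>j. x j = Sx (status \<theta> x (\<theta> j)) * centrality \<beta> w \<theta> G j \<and>
                status \<theta> x (\<theta> j) =
                  Sx (status \<theta> x (\<theta> j)) * group_mean \<theta> (centrality \<beta> w \<theta> G) (\<theta> j)
                  / (Sx (1 / status \<theta> x (\<theta> j)) * group_mean \<theta> (centrality \<beta> w \<theta> G) (other (\<theta> j)))))"
proof -
  let ?C = "centrality \<beta> w \<theta> G" and ?I = "{1/Z..Z}"
  let ?E = "\<lambda>x. equilibrium S \<beta> w \<theta> G x \<and> (\<forall>t. status \<theta> x t \<in> ?I)"
  let ?M = "group_mean \<theta> ?C"
  have C_lower: "1 / (1 + \<beta>) \<le> ?C j" for j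
    by (rule centrality_lower_bound[OF income G_nonneg G_radius \<beta>_pos])
  have C_upper: "?C j \<le> \<psi>" for j unfolding \<psi> by simp
  have M: "1 / (1 + \<beta>) \<le> ?M t" "?M t \<le> \<psi>" for t
    by (rule group_mean_bounds[OF groups_nonempty C_lower C_upper])+
  have "0 < 1 / (1 + \<beta>)" using \<beta>_pos by simp
  then have M_pos: "0 < ?M t" and C_pos: "0 < ?C j" for t j
    using M(1) C_lower by (meson less_le_trans)+
  have "1 \<le> \<psi> * (1 + \<beta>)"
    using order_trans[OF M] \<beta>_pos by (simp add: pos_divide_le_eq)
  then have Z1: "1 \<le> Z" using Z by linarith
  \<comment> \<open>The lower bound on \<open>Z\<close> serves here: one mean is at most \<psi> and
    the other at least 1 / (1 + \<beta>).\<close>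
  have ratio: "?M t / ?M (other t) \<le> Z" for t
  proof -
    have "?M t \<le> \<psi> * (1 + \<beta>) * (1 / (1 + \<beta>))" using M(2) \<beta>_pos by simp
    also have "\<dots> \<le> Z * ?M (other t)"
      using Z Z1 M \<beta>_pos by (intro mult_mono) simp_all
    finally show ?thesis using M_pos by (simp add: pos_divide_le_eq)
  qed
  \<comment> \<open>The upper bound on the inverse ratio, from \<open>ratio[of Id_B]\<close>,
    supplies the lower end \<open>1 / Z\<close>.\<close>
  have ratio_A: "?M Id_A / ?M Id_B \<in> ?I"
    using ratio[of Id_A] ratio[of Id_B] M_pos Z1 by (simp add: field_simps)
  have I_pos: "0 < Y" if "Y \<in> ?I" for Y
    using that Z1 by (auto intro: less_le_trans[of 0 "1/Z"])
  have I_inv: "1 / Y \<in> ?I" if "Y \<in> ?I" for Y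
    using that I_pos[OF that] Z1 by (auto simp: field_simps)
  note Sx_pos = status_utility_pos[OF utility]

  have status_scaled: "status \<theta> (\<lambda>j. s (\<theta> j) * ?C j) t = s t * ?M t / (s (other t) * ?M (other t))" for s t
    by (simp add: status_def group_mean_scaled)

  \<comment> \<open>Best responses give the linear system whose solution is scaled centrality.
    Conversely, such a profile is positive, so nonnegativity and positive group means come for
    free.\<close>
  have E_iff: "?E x \<longleftrightarrow> (\<forall>t. status \<theta> x t \<in> ?I) \<and> (\<forall>j. x j = Sx (status \<theta> x (\<theta> j)) * ?C j)" for x
  proof (cases "\<forall>t. status \<theta> x t \<in> ?I")
    case True
    then have s_pos: "0 < Sx (status \<theta> x t)" for t using Sx_pos by blast
    have br: "(\<forall>j. \<forall>y\<ge>0. payoff S \<beta> w \<theta> G j (status \<theta> x (\<theta> j)) (x(j := y))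
                 \<le> payoff S \<beta> w \<theta> G j (status \<theta> x (\<theta> j)) x) \<longleftrightarrow>
        (\<forall>j. x j = Sx (status \<theta> x (\<theta> j)) * ?C j)" if "\<And>j. 0 \<le> x j"
      unfolding group_scaled_fixed_point[OF income G_nonneg G_radius \<beta>_pos,
          where s = "\<lambda>t. Sx (status \<theta> x t)", symmetric]
      by (intro all_cong1 best_response_iff[OF utility True[rule_format] G_diag income \<beta>_pos G_nonneg that])
    have nonneg: "0 \<le> x j" and means: "0 < group_mean \<theta> x t"
      if "\<forall>j. x j = Sx (status \<theta> x (\<theta> j)) * ?C j" for j t
    proof -
      show "0 \<le> x j" using that s_pos C_pos by (metis mult_nonneg_nonneg less_imp_le)
      have "x = (\<lambda>j. Sx (status \<theta> x (\<theta> j)) * ?C j)" using that by blast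
      then have "group_mean \<theta> x t = Sx (status \<theta> x t) * ?M t"
        by (metis group_mean_scaled[where s = "\<lambda>t. Sx (status \<theta> x t)"])
      then show "0 < group_mean \<theta> x t" using s_pos M_pos by simp
    qed
    show ?thesis
      using br nonneg means True unfolding equilibrium_def by blast
  next
    case False
    then show ?thesis by blast
  qed

  \<comment> \<open>The profile generated by a conjectured status \<open>Y\<close> of group A, with
    \<open>1 / Y\<close> for group B.\<close>
  define sol where "sol Y j = Sx (if \<theta> j = Id_A then Y else 1 / Y) * ?C j" for Y j
  define eqn where "eqn Y \<longleftrightarrow> Y \<in> ?I \<and> Y = Sx Y * ?M Id_A / (Sx (1 / Y) * ?M Id_B)" for Y
  have status_sol: "status \<theta> (sol Y) Id_A = Sx Y * ?M Id_A / (Sx (1 / Y) * ?M Id_B)" for Y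
    using status_scaled[of "\<lambda>t. Sx (if t = Id_A then Y else 1 / Y)" Id_A] by (simp add: sol_def[abs_def])
  have status_B: "status \<theta> x Id_B = 1 / status \<theta> x Id_A" for x
    using status_other[of \<theta> x Id_A] by simp
  have all_identity: "(\<forall>t. P t) \<longleftrightarrow> P Id_A \<and> P Id_B" for P
    by (metis identity.exhaust)
  \<comment> \<open>Equilibria are the profiles reproduced by their own status. If
    \<open>x = sol (status \<theta> x Id_A)\<close>, the equation in \<open>eqn\<close> holds
    automatically and only membership in the interval is left.\<close>
  have E_sol: "?E x \<longleftrightarrow> eqn (status \<theta> x Id_A) \<and> x = sol (status \<theta> x Id_A)" for x
  proof -
    have "status \<theta> x (\<theta> j) = (if \<theta> j = Id_A then status \<theta> x Id_A else 1 / status \<theta> x Id_A)" for j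
      by (cases "\<theta> j") (auto simp: status_B)
    then have "(\<forall>j. x j = Sx (status \<theta> x (\<theta> j)) * ?C j) \<longleftrightarrow> x = sol (status \<theta> x Id_A)"
      by (auto simp: sol_def fun_eq_iff)
    moreover have "(\<forall>t. status \<theta> x t \<in> ?I) \<longleftrightarrow> status \<theta> x Id_A \<in> ?I"
      unfolding all_identity status_B using I_inv by blast
    moreover have "eqn (status \<theta> x Id_A) \<longleftrightarrow> status \<theta> x Id_A \<in> ?I" if "x = sol (status \<theta> x Id_A)"
      unfolding eqn_def using status_sol[of "status \<theta> x Id_A"] that by metis
    ultimately show ?thesis unfolding E_iff by blast
  qed
  have "\<exists>!Y. eqn Y"
    unfolding eqn_def by (rule status_equation_unique_solution[OF utility M_pos M_pos ratio_A Z1])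
  \<comment> \<open>With this, \<open>sol\<close> and the status of group A are mutually inverse
    between solutions of \<open>eqn\<close> and equilibria, which transfers unique
    existence.\<close>
  moreover have "status \<theta> (sol Y) Id_A = Y" if "eqn Y" for Y
    using that status_sol[of Y] unfolding eqn_def by metis
  ultimately have "\<exists>!x. ?E x"
    using E_sol by metis
  moreover have "x j = Sx (status \<theta> x (\<theta> j)) * ?C j \<and>
      status \<theta> x (\<theta> j) = Sx (status \<theta> x (\<theta> j)) * ?M (\<theta> j)
        / (Sx (1 / status \<theta> x (\<theta> j)) * ?M (other (\<theta> j)))" if "?E x" for x j
  proof -
    have x: "\<forall>j. x j = Sx (status \<theta> x (\<theta> j)) * ?C j" using that unfolding E_iff by blast
    then have "x = (\<lambda>j. Sx (status \<theta> x (\<theta> j)) * ?C j)" by blast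
    \<comment> \<open>The status of a scaled centrality profile is the right-hand side of the
      equation once the other group's status is rewritten as the reciprocal; this covers both groups
      at once.\<close>
    then have "status \<theta> x (\<theta> j) = Sx (status \<theta> x (\<theta> j)) * ?M (\<theta> j)
        / (Sx (status \<theta> x (other (\<theta> j))) * ?M (other (\<theta> j)))"
      by (metis status_scaled[where s = "\<lambda>t. Sx (status \<theta> x t)"])
    with x show ?thesis by (simp only: status_other)
  qed
  ultimately show ?thesis by blast
qed

end
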